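(* Let $H$ be a Heyting algebra and let $M$ be a Heyting module over $H$. Then the collection $Sub(M)$ of Heyting submodules of $M$, with the topology having the sets $V(m_1,\dots,m_n)$ as a subbasis of closed sets, is a spectral space having the collection $\mathcal S$ of subsets of the form $D(m_1,\dots,m_n)$ as a subbasis of quasi-compact open sets.
   Context: Lattices have all finite meets and joins (hence a least element $0$ and a greatest element $1$). A join semilattice is a poset in which every finite subset, including the empty one, has a join; its least element is $0$. For a distributive lattice $L$, a distributive module over $L$ is a join semilattice $M$ with an action $L\times M\to M$, $(x,m)\mapsto x\wedge m$, order preserving in both variables, such that $1\wedge m=m$, $0\wedge m=0$, $(x\wedge y)\wedge m=x\wedge(y\wedge m)$, $(x\vee y)\wedge m=(x\wedge m)\vee(y\wedge m)$, $x\wedge(m\vee n)=(x\wedge m)\vee(x\wedge n)$. A Heyting algebra $H$ (not assumed finite here) is a lattice such that for all $y,z\in H$ there is $(y\to z)_H\in H$ with $x\wedge y\le z\Leftrightarrow x\le (y\to z)_H$ for all $x\in H$. A Heyting module over $H$ is a distributive module $M$ over $H$ such that for all $m,n\in M$ there is $(m\to n)_M\in H$ with $x\wedge m\le n\Leftrightarrow x\le(m\to n)_M$ for all $x\in H$. A Heyting submodule of $M$ is a subset closed under finite joins (so containing $0$) and under the action of $H$. For a finite collection $m_1,\dots,m_n$ of elements of $M$ set $V(m_1,\dots,m_n)=\{N\in Sub(M) : m_1,\dots,m_n\in N\}$ and $D(m_1,\dots,m_n)=Sub(M)\setminus V(m_1,\dots,m_n)$. A topological space is spectral if it is homeomorphic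 to the Zariski spectrum of a commutative ring; equivalently (Hochster) it is quasi-compact, its quasi-compact open subsets are closed under (finite) intersection and form a basis, and every non-empty irreducible closed subset has a unique generic point. *)

theory Defs
  imports "HOL-Analysis.Abstract_Topology"
begin

section \<open>Heyting algebras and Heyting modules\<close>

class heyting_algebra = bounded_lattice +
  assumes ex_relative_pseudocomplement:
    "\<exists>i. \<forall>x. inf x y \<le> z \<longleftrightarrow> x \<le> i"
begin

text \<open>Distributivity follows from the adjunction, so that a module over a Heyting algebra
  is a module over a distributive lattice.\<close>

subclass distrib_lattice
proof
  have *: "inf x (sup y z) \<le> sup (inf x y) (inf x z)" for x y z
  proof -
    obtain i where i: "\<And>w. inf w x \<le> sup (inf x y) (inf x z) \<longleftrightarrow> w \<le> i"
      using ex_relative_pseudocomplement by blast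
    have "y \<le> i" "z \<le> i"
      by (simp_all add: i[symmetric] inf_commute)
    then have "sup y z \<le> i" by simp
    then show ?thesis by (simp add: i[symmetric] inf_commute)
  qed
  show "sup x (inf y z) = inf (sup x y) (sup x z)" for x y z
    by (rule distrib_imp1, rule order.antisym[OF *]) (simp add: le_infI2)
qed

end

locale distributive_module =
  fixes act :: "'l::{distrib_lattice, bounded_lattice} \<Rightarrow> 'm::bounded_semilattice_sup_bot \<Rightarrow> 'm"
  assumes act_mono: "x \<le> y \<Longrightarrow> m \<le> n \<Longrightarrow> act x m \<le> act y n"
    and act_top: "act top m = m"
    and act_bot: "act bot m = bot"
    and act_inf: "act (inf x y) m = act x (act y m)"
    and act_sup_left: "act (sup x y) m = sup (act x m) (act y m)"
    and act_sup_right: "act x (sup m n) = sup (act x m) (act x n)"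

locale heyting_module = distributive_module act
  for act :: "'h::heyting_algebra \<Rightarrow> 'm::bounded_semilattice_sup_bot \<Rightarrow> 'm" +
  assumes ex_module_implication: "\<exists>i. \<forall>x. act x m \<le> n \<longleftrightarrow> x \<le> i"

definition Sub :: "('h \<Rightarrow> 'm::bounded_semilattice_sup_bot \<Rightarrow> 'm) \<Rightarrow> 'm set set" where
  "Sub act = {N. bot \<in> N \<and> (\<forall>m\<in>N. \<forall>n\<in>N. sup m n \<in> N) \<and> (\<forall>x. \<forall>m\<in>N. act x m \<in> N)}"

text \<open>The finite collection \<open>m\<^sub>1, \<dots>, m\<^sub>n\<close> is given as the finite set \<open>F\<close> of its members.\<close>

definition V :: "('h \<Rightarrow> 'm::bounded_semilattice_sup_bot \<Rightarrow> 'm) \<Rightarrow> 'm set \<Rightarrow> 'm set set" where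
  "V act F = {N \<in> Sub act. F \<subseteq> N}"

definition D :: "('h \<Rightarrow> 'm::bounded_semilattice_sup_bot \<Rightarrow> 'm) \<Rightarrow> 'm set \<Rightarrow> 'm set set" where
  "D act F = Sub act - V act F"


section \<open>Subbases and spectral spaces\<close>

text \<open>The relativisation to \<open>U\<close> only affects the empty intersection, which in the library is
  \<open>UNIV\<close> and here has to be the whole space. This matters: the sets \<open>D act F\<close> never cover
  \<open>Sub act\<close>, since the improper submodule lies in none of them, so
  \<open>topology_generated_by\<close> would give too small a space.\<close>

definition topology_of_closed_subbase :: "'a set \<Rightarrow> 'a set set \<Rightarrow> 'a topology" where
  "topology_of_closed_subbase U \<C> =
     topology (\<lambda>S. S \<subseteq> U \<and>
       (arbitrary intersection_of (finite union_of (\<lambda>C. C \<in> \<C>)) relative_to U) (U - S))"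

definition open_subbase :: "'a topology \<Rightarrow> 'a set set \<Rightarrow> bool" where
  "open_subbase X \<S> \<longleftrightarrow>
     openin X = arbitrary union_of (finite intersection_of (\<lambda>S. S \<in> \<S>) relative_to topspace X)"

definition irreducible_closedin :: "'a topology \<Rightarrow> 'a set \<Rightarrow> bool" where
  "irreducible_closedin X Z \<longleftrightarrow> closedin X Z \<and> Z \<noteq> {} \<and>
     (\<forall>A B. closedin X A \<and> closedin X B \<and> Z \<subseteq> A \<union> B \<longrightarrow> Z \<subseteq> A \<or> Z \<subseteq> B)"

text \<open>Spectral spaces in Hochster's intrinsic form. Note that \<open>compact_space\<close> and \<open>compactin\<close>
  carry no separation axiom, i.e. mean quasi-compactness. Finite intersections of quasi-compact
  open sets are covered by the binary ones and, for the empty one, compactness of the space.\<close>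

definition spectral_space :: "'a topology \<Rightarrow> bool" where
  "spectral_space X \<longleftrightarrow>
     compact_space X \<and>
     (\<forall>A B. openin X A \<and> compactin X A \<and> openin X B \<and> compactin X B
        \<longrightarrow> compactin X (A \<inter> B)) \<and>
     openin X = arbitrary union_of (\<lambda>A. openin X A \<and> compactin X A) \<and>
     (\<forall>Z. irreducible_closedin X Z \<longrightarrow> (\<exists>!x. x \<in> topspace X \<and> X closure_of {x} = Z))"

definition Sub_topology :: "('h \<Rightarrow> 'm::bounded_semilattice_sup_bot \<Rightarrow> 'm) \<Rightarrow> 'm set topology" where
  "Sub_topology act = topology_of_closed_subbase (Sub act) {V act F | F. finite F}"


text \<open>\<open>topology\<close> is only meaningful on predicates satisfying \<open>istopology\<close>; the following facts
  confirm that this is the case and that \<open>topology_of_closed_subbase U \<C>\<close> is the topology on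
  \<open>U\<close> with the intended closed sets.\<close>

lemma closed_subbase_complement:
  assumes "S \<subseteq> U"
  shows "(arbitrary intersection_of (finite union_of (\<lambda>C. C \<in> \<C>)) relative_to U) (U - S) \<longleftrightarrow>
    (arbitrary union_of (finite intersection_of (\<lambda>A. - A \<in> \<C>) relative_to U)) S"
proof -
  have "(\<lambda>T. (arbitrary intersection_of (finite union_of (\<lambda>C. C \<in> \<C>))) (- T)) =
      arbitrary union_of (finite intersection_of (\<lambda>A. - A \<in> \<C>))"
    by (rule ext) (simp only: arbitrary_intersection_of_complement finite_union_of_complement
        double_compl)
  then show ?thesis
    by (simp only: relative_to_compl[OF assms] arbitrary_union_of_relative_to)
qed

lemma topology_of_closed_subbase_alt:
  "topology_of_closed_subbase U \<C> =
     topology (arbitrary union_of (finite intersection_of (\<lambda>A. - A \<in> \<C>) relative_to U))"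
proof -
  have sub: "S \<subseteq> U"
    if "(arbitrary union_of (finite intersection_of (\<lambda>A. - A \<in> \<C>) relative_to U)) S" for S
    using that by (auto simp: union_of_def relative_to_def)
  show ?thesis
    unfolding topology_of_closed_subbase_def
    by (intro arg_cong[where f = topology] ext iffI conjI, elim conjE)
      (simp_all only: closed_subbase_complement sub)
qed

lemma topspace_topology_of_closed_subbase [simp]:
  "topspace (topology_of_closed_subbase U \<C>) = U"
  by (simp add: topology_of_closed_subbase_alt)

lemma closedin_topology_of_closed_subbase:
  "closedin (topology_of_closed_subbase U \<C>) Z \<longleftrightarrow>
     (arbitrary intersection_of (finite union_of (\<lambda>C. C \<in> \<C>)) relative_to U) Z"
    (is "_ \<longleftrightarrow> ?P Z")
proof -
  have *: "openin (topology_of_closed_subbase U \<C>) (U - Z) \<longleftrightarrow> ?P (U - (U - Z))"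
    unfolding topology_of_closed_subbase_alt openin_subbase
    by (rule closed_subbase_complement[OF Diff_subset, symmetric])
  show ?thesis
  proof (cases "Z \<subseteq> U")
    case True
    then have "U - (U - Z) = Z" by blast
    with * True show ?thesis
      by (simp only: closedin_def topspace_topology_of_closed_subbase simp_thms)
  next
    case False
    moreover from False have "\<not> ?P Z" by (blast dest: relative_to_imp_subset)
    ultimately show ?thesis
      by (simp only: closedin_def topspace_topology_of_closed_subbase simp_thms)
  qed
qed

end

theory Submission
  imports Defs "HOL-Analysis.Function_Topology"
begin

text \<open>The sets in \<open>Sub act\<close> are the closed sets of a finitary closure operator, so if \<open>F\<close> is
  finite and lies in the submodule generated by a union of finite sets, then it lies in the
  submodule generated by finitely many of them. By the Alexander subbase theorem this makes
  non-empty finite intersections of sets \<open>D act F\<close> quasi-compact; for the empty intersection, the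
  only open set containing the improper submodule is the whole space. The closure of \<open>{N}\<close>
  consists of the submodules containing \<open>N\<close>, and an irreducible closed \<open>Z\<close> contains \<open>\<Inter>Z\<close>:
  when \<open>Z\<close> is covered by finitely many sets \<open>V act F\<close> it lies in one of them, and then so does
  \<open>\<Inter>Z\<close>.\<close>

section \<open>Generated submodules and finitary closure\<close>

definition generated_Sub :: "('h \<Rightarrow> 'm::bounded_semilattice_sup_bot \<Rightarrow> 'm) \<Rightarrow> 'm set \<Rightarrow> 'm set" where
  "generated_Sub act A = \<Inter>{N \<in> Sub act. A \<subseteq> N}"

lemma UNIV_in_Sub: "UNIV \<in> Sub act"
  by (simp add: Sub_def)

lemma Inter_in_Sub: "\<N> \<subseteq> Sub act \<Longrightarrow> \<Inter>\<N> \<in> Sub act"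
  unfolding Sub_def by blast

lemma generated_Sub_in_Sub: "generated_Sub act A \<in> Sub act"
  unfolding generated_Sub_def by (rule Inter_in_Sub) blast

lemma subset_generated_Sub: "A \<subseteq> generated_Sub act A"
  unfolding generated_Sub_def by blast

lemma generated_Sub_least: "N \<in> Sub act \<Longrightarrow> A \<subseteq> N \<Longrightarrow> generated_Sub act A \<subseteq> N"
  unfolding generated_Sub_def by blast

lemma generated_Sub_mono: "A \<subseteq> B \<Longrightarrow> generated_Sub act A \<subseteq> generated_Sub act B"
  unfolding generated_Sub_def by blast

text \<open>Finite subfamilies are directed under union, so the submodules that they generate form a
  directed system. The union \<open>U\<close> of this system is again a submodule, and it contains
  every member of \<open>\<F>\<close>.\<close>

lemma generated_Sub_Union_finitary:
  assumes "m \<in> generated_Sub act (\<Union>\<F>)"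
  shows "\<exists>\<G>. finite \<G> \<and> \<G> \<subseteq> \<F> \<and> m \<in> generated_Sub act (\<Union>\<G>)"
proof -
  define U where "U = (\<Union>\<G>\<in>{\<G>. finite \<G> \<and> \<G> \<subseteq> \<F>}. generated_Sub act (\<Union>\<G>))"
  have memI: "m \<in> U" if "finite \<G>" "\<G> \<subseteq> \<F>" "m \<in> generated_Sub act (\<Union>\<G>)" for m \<G>
    using that unfolding U_def by blast
  have gen: "bot \<in> generated_Sub act A"
    "m \<in> generated_Sub act A \<Longrightarrow> n \<in> generated_Sub act A \<Longrightarrow> sup m n \<in> generated_Sub act A"
    "m \<in> generated_Sub act A \<Longrightarrow> act x m \<in> generated_Sub act A" for A x m n
    using generated_Sub_in_Sub[of act A] by (auto simp: Sub_def)
  have "sup m n \<in> U" if "m \<in> U" "n \<in> U" for m n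
  proof -
    obtain \<G> \<H> where GH: "finite \<G>" "\<G> \<subseteq> \<F>" "m \<in> generated_Sub act (\<Union>\<G>)"
      "finite \<H>" "\<H> \<subseteq> \<F>" "n \<in> generated_Sub act (\<Union>\<H>)"
      using \<open>m \<in> U\<close> \<open>n \<in> U\<close> unfolding U_def by blast
    have "generated_Sub act (\<Union>\<G>) \<subseteq> generated_Sub act (\<Union>(\<G> \<union> \<H>))"
      "generated_Sub act (\<Union>\<H>) \<subseteq> generated_Sub act (\<Union>(\<G> \<union> \<H>))"
      by (rule generated_Sub_mono; blast)+
    with GH show ?thesis
      by (intro memI[of "\<G> \<union> \<H>"] gen(2)) auto
  qed
  moreover have "act x m \<in> U" if "m \<in> U" for x m
    using that gen(3) unfolding U_def by blast
  \<comment> \<open>The empty subfamily already generates a submodule containing \<open>bot\<close>,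
    so this holds even for empty \<open>\<F>\<close>.\<close>
  moreover have "bot \<in> U"
    by (rule memI[of "{}"]) (simp_all add: gen(1))
  ultimately have "U \<in> Sub act"
    unfolding Sub_def by blast
  moreover have "\<Union>\<F> \<subseteq> U"
  proof
    fix m assume "m \<in> \<Union>\<F>"
    then obtain F where "F \<in> \<F>" "m \<in> F" by blast
    then show "m \<in> U"
      using subset_generated_Sub[of F act] by (intro memI[of "{F}"]) auto
  qed
  ultimately have "generated_Sub act (\<Union>\<F>) \<subseteq> U"
    by (rule generated_Sub_least)
  with assms show ?thesis
    unfolding U_def by blast
qed

lemma finite_subset_generated_Sub_Union:
  assumes "finite F" "F \<subseteq> generated_Sub act (\<Union>\<F>)"
  shows "\<exists>\<G>. finite \<G> \<and> \<G> \<subseteq> \<F> \<and> F \<subseteq> generated_Sub act (\<Union>\<G>)"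
proof -
  have "\<forall>m\<in>F. \<exists>\<G>. finite \<G> \<and> \<G> \<subseteq> \<F> \<and> m \<in> generated_Sub act (\<Union>\<G>)"
    using assms(2) generated_Sub_Union_finitary by blast
  then obtain g where g: "\<And>m. m \<in> F \<Longrightarrow> finite (g m) \<and> g m \<subseteq> \<F> \<and> m \<in> generated_Sub act (\<Union>(g m))"
    by metis
  show ?thesis
  proof (intro exI[of _ "\<Union>(g ` F)"] conjI subsetI)
    fix m assume "m \<in> F"
    then have "generated_Sub act (\<Union>(g m)) \<subseteq> generated_Sub act (\<Union>(\<Union>(g ` F)))"
      by (intro generated_Sub_mono) blast
    with g[OF \<open>m \<in> F\<close>] show "m \<in> generated_Sub act (\<Union>(\<Union>(g ` F)))" by blast
  qed (use g assms(1) in auto)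
qed

section \<open>The topology through its open subbase\<close>

lemma topspace_Sub_topology [simp]: "topspace (Sub_topology act) = Sub act"
  by (simp add: Sub_topology_def)

text \<open>The complement \<open>- V act F\<close> is taken in the whole type and also contains
  sets that are not submodules. Its trace on \<open>Sub act\<close> is \<open>D act F\<close>, so
  both families become the same subbase after relativisation.\<close>

lemma Sub_topology_eq:
  "Sub_topology act = topology (arbitrary union_of
     (finite intersection_of (\<lambda>S. S \<in> {D act F | F. finite F}) relative_to Sub act))"
proof -
  let ?P = "\<lambda>A. - A \<in> {V act F | F. finite F}" and ?Q = "\<lambda>S. S \<in> {D act F | F. finite F}"
  have "(?P relative_to Sub act) S \<longleftrightarrow> (?Q relative_to Sub act) S" for S
  proof
    assume "(?P relative_to Sub act) S"
    then obtain A F where "- A = V act F" "finite F" "S = Sub act \<inter> A"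
      unfolding relative_to_def by blast
    then have "S = Sub act \<inter> D act F"
      unfolding D_def by blast
    with \<open>finite F\<close> show "(?Q relative_to Sub act) S"
      unfolding relative_to_def by blast
  next
    assume "(?Q relative_to Sub act) S"
    then obtain F where "finite F" "S = Sub act \<inter> - V act F"
      unfolding relative_to_def D_def by blast
    moreover have "?P (- V act F)"
      using \<open>finite F\<close> by auto
    ultimately show "(?P relative_to Sub act) S"
      unfolding relative_to_def by blast
  qed
  then have eq: "?P relative_to Sub act = ?Q relative_to Sub act"
    by blast
  \<comment> \<open>The trace of a finite intersection on \<open>Sub act\<close> depends only on the
    traces of its members.\<close>
  have "finite intersection_of ?P relative_to Sub act = finite intersection_of ?Q relative_to Sub act"
    by (simp only: eq finite_intersection_of_relative_to[of ?P] finite_intersection_of_relative_to[of ?Q])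
  then show ?thesis
    unfolding Sub_topology_def topology_of_closed_subbase_alt by simp
qed

lemma openin_Sub_topology:
  "openin (Sub_topology act) = arbitrary union_of
     (finite intersection_of (\<lambda>S. S \<in> {D act F | F. finite F}) relative_to Sub act)"
  unfolding Sub_topology_eq by (rule ext) (rule openin_subbase)

text \<open>Indexing basic open sets by families \<open>\<F>\<close> makes their intersections
  correspond to unions of index families. The factor \<open>Sub act\<close> makes the empty family
  give the whole space.\<close>

lemma Sub_topology_base_iff:
  "(finite intersection_of (\<lambda>S. S \<in> {D act F | F. finite F}) relative_to Sub act) B \<longleftrightarrow>
   (\<exists>\<F>. finite \<F> \<and> (\<forall>F\<in>\<F>. finite F) \<and> B = Sub act \<inter> \<Inter>(D act ` \<F>))"
proof
  assume "(finite intersection_of (\<lambda>S. S \<in> {D act F | F. finite F}) relative_to Sub act) B"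
  then obtain \<U> where U: "finite \<U>" "\<U> \<subseteq> D act ` {F. finite F}" "B = Sub act \<inter> \<Inter>\<U>"
    unfolding relative_to_def intersection_of_def by auto
  then obtain \<F> where "finite \<F>" "\<F> \<subseteq> {F. finite F}" "\<U> = D act ` \<F>"
    by (metis finite_subset_image)
  with U show "\<exists>\<F>. finite \<F> \<and> (\<forall>F\<in>\<F>. finite F) \<and> B = Sub act \<inter> \<Inter>(D act ` \<F>)"
    by blast
next
  assume "\<exists>\<F>. finite \<F> \<and> (\<forall>F\<in>\<F>. finite F) \<and> B = Sub act \<inter> \<Inter>(D act ` \<F>)"
  then obtain \<F> where "finite \<F>" "\<forall>F\<in>\<F>. finite F" "B = Sub act \<inter> \<Inter>(D act ` \<F>)"
    by blast
  then show "(finite intersection_of (\<lambda>S. S \<in> {D act F | F. finite F}) relative_to Sub act) B"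
    unfolding relative_to_def intersection_of_def
    by (intro exI[of _ "\<Inter>(D act ` \<F>)"] conjI exI[of _ "D act ` \<F>"]) auto
qed

lemma openin_Sub_topology_base:
  assumes "finite \<F>" "\<forall>F\<in>\<F>. finite F"
  shows "openin (Sub_topology act) (Sub act \<inter> \<Inter>(D act ` \<F>))"
  unfolding openin_Sub_topology
  by (rule arbitrary_union_of_inc) (use assms in \<open>auto simp only: Sub_topology_base_iff\<close>)

lemma Sub_topology_base_neighbourhood:
  assumes "openin (Sub_topology act) U" "N \<in> U"
  obtains \<F> where "finite \<F>" "\<forall>F\<in>\<F>. finite F"
    "N \<in> Sub act \<inter> \<Inter>(D act ` \<F>)" "Sub act \<inter> \<Inter>(D act ` \<F>) \<subseteq> U"
proof -
  obtain B where B: "(finite intersection_of (\<lambda>S. S \<in> {D act F | F. finite F}) relative_to Sub act) B"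
    "N \<in> B" "B \<subseteq> U"
    using assms by (auto simp only: openin_Sub_topology arbitrary_union_of_alt)
  then obtain \<F> where "finite \<F>" "\<forall>F\<in>\<F>. finite F" "B = Sub act \<inter> \<Inter>(D act ` \<F>)"
    by (auto simp only: Sub_topology_base_iff)
  with B show thesis by (intro that) simp_all
qed

text \<open>If \<open>F\<close> is not contained in \<open>N\<close>, it is not contained in any
  smaller submodule; so each \<open>D act F\<close>, and hence each open set, is closed downwards.
  This drives both the compactness of the space and the description of point closures.\<close>

lemma openin_Sub_topology_antimono:
  assumes "openin (Sub_topology act) U" "N \<in> U" "N' \<in> Sub act" "N' \<subseteq> N"
  shows "N' \<in> U"
proof -
  obtain \<F> where \<F>: "N \<in> Sub act \<inter> \<Inter>(D act ` \<F>)" "Sub act \<inter> \<Inter>(D act ` \<F>) \<subseteq> U"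
    using Sub_topology_base_neighbourhood[OF assms(1,2)] .
  have "N' \<in> D act F" if "F \<in> \<F>" for F
    using \<F>(1) assms(3,4) that unfolding D_def V_def by blast
  with \<F>(2) assms(3) show ?thesis by blast
qed

lemma openin_D:
  assumes "finite F"
  shows "openin (Sub_topology act) (D act F)"
proof -
  have "Sub act \<inter> \<Inter>(D act ` {F}) = D act F"
    by (auto simp: D_def)
  with openin_Sub_topology_base[of "{F}" act] assms show ?thesis by simp
qed

lemma closedin_V:
  assumes "finite F"
  shows "closedin (Sub_topology act) (V act F)"
  using openin_D[OF assms, of act] by (auto simp: closedin_def D_def V_def)

section \<open>Quasi-compact open sets\<close>

lemma compact_space_Sub_topology: "compact_space (Sub_topology act)"
  unfolding compact_space_def compactin_def topspace_Sub_topology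
proof (intro conjI allI impI subset_refl)
  fix \<U> assume \<U>: "Ball \<U> (openin (Sub_topology act)) \<and> Sub act \<subseteq> \<Union>\<U>"
  then obtain U where U: "U \<in> \<U>" "UNIV \<in> U"
    using UNIV_in_Sub[of act] by blast
  with \<U> have "Sub act \<subseteq> U"
    using openin_Sub_topology_antimono[of act U UNIV] by blast
  with U show "\<exists>\<F>. finite \<F> \<and> \<F> \<subseteq> \<U> \<and> Sub act \<subseteq> \<Union>\<F>"
    by (intro exI[of _ "{U}"]) auto
qed

lemma compactin_Sub_topology_base:
  assumes "\<forall>F\<in>\<F>. finite F"
  shows "compactin (Sub_topology act) (Sub act \<inter> \<Inter>(D act ` \<F>))" (is "compactin ?X ?K")
proof (cases "\<F> = {}")
  case True
  with compact_space_Sub_topology[of act] show ?thesis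
    by (simp add: compact_space_def)
next
  case False
  let ?\<B> = "{D act F | F. finite F}"
  have "compact_space (subtopology ?X ?K)"
  proof (rule Alexander_subbase_alt)
    \<comment> \<open>Alexander's criterion asks the subbase to cover the set. A single member of
      the non-empty \<open>\<F>\<close> achieves this; no sets \<open>D act F\<close> cover
      \<open>Sub act\<close> itself, hence the case split.\<close>
    show "?K \<subseteq> \<Union>?\<B>"
      using False assms by blast
    show "topology (arbitrary union_of (finite intersection_of (\<lambda>x. x \<in> ?\<B>) relative_to ?K)) =
        subtopology ?X ?K"
    proof -
      have "openin ?X relative_to ?K =
          arbitrary union_of (finite intersection_of (\<lambda>x. x \<in> ?\<B>) relative_to Sub act \<inter> ?K)"
        by (simp only: openin_Sub_topology arbitrary_union_of_relative_to relative_to_relative_to)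
      moreover have "Sub act \<inter> ?K = ?K" by blast
      ultimately show ?thesis
        by (metis openin_inverse openin_relative_to)
    qed
  next
    fix C assume C: "C \<subseteq> ?\<B>" "?K \<subseteq> \<Union>C"
    define \<H> where "\<H> = {F. finite F \<and> D act F \<in> C}"
    have CH: "C = D act ` \<H>"
      using C(1) unfolding \<H>_def by blast
    \<comment> \<open>The submodule generated by all of \<open>\<H>\<close> is the test point: it
      escapes every member of the cover, so it lies outside \<open>?K\<close> and must contain some
      \<open>F\<close> from \<open>\<F>\<close>.\<close>
    have "generated_Sub act (\<Union>\<H>) \<notin> D act F" if "F \<in> \<H>" for F
      using subset_generated_Sub[of "\<Union>\<H>" act] that by (auto simp: D_def V_def)
    then have "generated_Sub act (\<Union>\<H>) \<notin> ?K"
      using C(2) unfolding CH by blast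
    then obtain F where F: "F \<in> \<F>" "F \<subseteq> generated_Sub act (\<Union>\<H>)"
      using generated_Sub_in_Sub[of act "\<Union>\<H>"] unfolding D_def V_def by blast
    with assms obtain \<G> where \<G>: "finite \<G>" "\<G> \<subseteq> \<H>" "F \<subseteq> generated_Sub act (\<Union>\<G>)"
      using finite_subset_generated_Sub_Union by metis
    \<comment> \<open>A submodule missed by the finite subfamily contains
      \<open>\<Union>\<G>\<close>, hence \<open>F\<close>, which excludes it from
      \<open>D act F\<close> and so from \<open>?K\<close>.\<close>
    have "N \<in> \<Union>(D act ` \<G>)" if "N \<in> ?K" for N
    proof (rule ccontr)
      assume "N \<notin> \<Union>(D act ` \<G>)"
      with that have "\<Union>\<G> \<subseteq> N" "N \<in> Sub act"
        by (auto simp: D_def V_def)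
      with \<G>(3) have "F \<subseteq> N"
        using generated_Sub_least by blast
      with that F(1) show False
        unfolding D_def V_def by blast
    qed
    with \<G> show "\<exists>C'. finite C' \<and> C' \<subseteq> C \<and> ?K \<subseteq> \<Union>C'"
      unfolding CH by (intro exI[of _ "D act ` \<G>"]) blast
  qed
  then show ?thesis
    by (simp add: compactin_subspace)
qed

lemma compactin_D:
  assumes "finite F"
  shows "compactin (Sub_topology act) (D act F)"
proof -
  have "Sub act \<inter> \<Inter>(D act ` {F}) = D act F"
    by (auto simp: D_def)
  with compactin_Sub_topology_base[of "{F}" act] assms show ?thesis by simp
qed

lemma open_subbase_Sub_topology: "open_subbase (Sub_topology act) {D act F | F. finite F}"
  unfolding open_subbase_def topspace_Sub_topology by (rule openin_Sub_topology)

lemma openin_Sub_topology_compact_base: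
  "openin (Sub_topology act) =
    arbitrary union_of (\<lambda>A. openin (Sub_topology act) A \<and> compactin (Sub_topology act) A)"
  unfolding openin_topology_base_unique
proof (intro conjI allI impI)
  fix U N assume U: "openin (Sub_topology act) U \<and> N \<in> U"
  obtain \<F> where "finite \<F>" "\<forall>F\<in>\<F>. finite F"
    "N \<in> Sub act \<inter> \<Inter>(D act ` \<F>)" "Sub act \<inter> \<Inter>(D act ` \<F>) \<subseteq> U"
    using Sub_topology_base_neighbourhood[OF conjunct1[OF U] conjunct2[OF U]] .
  then show "\<exists>A. (openin (Sub_topology act) A \<and> compactin (Sub_topology act) A) \<and> N \<in> A \<and> A \<subseteq> U"
    by (intro exI[of _ "Sub act \<inter> \<Inter>(D act ` \<F>)"] conjI openin_Sub_topology_base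
        compactin_Sub_topology_base)
qed simp

text \<open>The basic open sets inside \<open>A\<close> cover it because \<open>A\<close> is open,
  and compactness leaves finitely many of them.\<close>

lemma compact_open_Sub_topology:
  assumes "openin (Sub_topology act) A" "compactin (Sub_topology act) A"
  shows "\<exists>\<Phi>. finite \<Phi> \<and> (\<forall>\<F>\<in>\<Phi>. finite \<F> \<and> (\<forall>F\<in>\<F>. finite F)) \<and>
    A = (\<Union>\<F>\<in>\<Phi>. Sub act \<inter> \<Inter>(D act ` \<F>))"
proof -
  let ?E = "\<lambda>\<F>. Sub act \<inter> \<Inter>(D act ` \<F>)"
  let ?\<Psi> = "{\<F>. finite \<F> \<and> (\<forall>F\<in>\<F>. finite F) \<and> ?E \<F> \<subseteq> A}"
  have "\<forall>U\<in>?E ` ?\<Psi>. openin (Sub_topology act) U"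
    using openin_Sub_topology_base by blast
  moreover have "A \<subseteq> \<Union>(?E ` ?\<Psi>)"
  proof
    fix N assume "N \<in> A"
    with assms(1) obtain \<F> where "finite \<F>" "\<forall>F\<in>\<F>. finite F" "N \<in> ?E \<F>" "?E \<F> \<subseteq> A"
      by (rule Sub_topology_base_neighbourhood)
    then show "N \<in> \<Union>(?E ` ?\<Psi>)"
      by (intro UnionI[of "?E \<F>"] imageI CollectI conjI)
  qed
  ultimately obtain \<V> where \<V>: "finite \<V>" "\<V> \<subseteq> ?E ` ?\<Psi>" "A \<subseteq> \<Union>\<V>"
    using assms(2) unfolding compactin_def by meson
  then obtain \<Phi> where "finite \<Phi>" "\<Phi> \<subseteq> ?\<Psi>" "\<V> = ?E ` \<Phi>"
    using finite_subset_image[OF \<V>(1,2)] by blast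
  with \<V>(3) show ?thesis
    by (intro exI[of _ \<Phi>]) blast
qed

lemma compactin_Int_Sub_topology:
  assumes "openin (Sub_topology act) A" "compactin (Sub_topology act) A"
    and "openin (Sub_topology act) B" "compactin (Sub_topology act) B"
  shows "compactin (Sub_topology act) (A \<inter> B)"
proof -
  let ?E = "\<lambda>\<F>. Sub act \<inter> \<Inter>(D act ` \<F>)"
  obtain \<Phi> \<Psi> where \<Phi>: "finite \<Phi>" "\<forall>\<F>\<in>\<Phi>. \<forall>F\<in>\<F>. finite F" "A = \<Union>(?E ` \<Phi>)"
    and \<Psi>: "finite \<Psi>" "\<forall>\<G>\<in>\<Psi>. \<forall>F\<in>\<G>. finite F" "B = \<Union>(?E ` \<Psi>)"
    using compact_open_Sub_topology[OF assms(1,2)] compact_open_Sub_topology[OF assms(3,4)] by metis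
  \<comment> \<open>Intersection distributes over the two finite unions, and two basic sets meet in
    the basic set of the joined index family, which is again compact.\<close>
  have "A \<inter> B = \<Union>((\<lambda>(\<F>, \<G>). ?E (\<F> \<union> \<G>)) ` (\<Phi> \<times> \<Psi>))"
    unfolding \<Phi>(3) \<Psi>(3) by auto
  moreover have "compactin (Sub_topology act) \<dots>"
    using \<Phi>(1,2) \<Psi>(1,2)
    by (intro compactin_Union) (auto intro!: compactin_Sub_topology_base)
  ultimately show ?thesis by simp
qed

section \<open>Point closures and generic points\<close>

text \<open>The closure lies in the closed set \<open>V act {m}\<close> for every \<open>m\<close>
  in \<open>N\<close>. Conversely, an open neighbourhood of a submodule above \<open>N\<close> is
  closed downwards and so contains \<open>N\<close>.\<close>

lemma closure_of_singleton_Sub_topology: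
  assumes "N \<in> Sub act"
  shows "Sub_topology act closure_of {N} = {N' \<in> Sub act. N \<subseteq> N'}"
proof (intro equalityI subsetI)
  fix N' assume N': "N' \<in> Sub_topology act closure_of {N}"
  have "m \<in> N'" if "m \<in> N" for m
  proof -
    have "Sub_topology act closure_of {N} \<subseteq> V act {m}"
      using assms that by (intro closure_of_minimal closedin_V) (auto simp: V_def)
    with N' show ?thesis by (auto simp: V_def)
  qed
  with N' show "N' \<in> {N' \<in> Sub act. N \<subseteq> N'}"
    using closure_of_subset_topspace[of "Sub_topology act" "{N}"] by auto
next
  fix N' assume "N' \<in> {N' \<in> Sub act. N \<subseteq> N'}"
  then show "N' \<in> Sub_topology act closure_of {N}"
    using openin_Sub_topology_antimono[of act _ N' N] assms by (auto simp: in_closure_of)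
qed

text \<open>Extends irreducibility from two closed sets to finitely many; the empty cover is ruled
  out by \<open>Z \<noteq> {}\<close>.\<close>

lemma irreducible_closedin_Union:
  assumes "irreducible_closedin X Z" "finite \<A>" "\<And>A. A \<in> \<A> \<Longrightarrow> closedin X A" "Z \<subseteq> \<Union>\<A>"
  shows "\<exists>A\<in>\<A>. Z \<subseteq> A"
  using assms(2-)
proof (induction \<A> rule: finite_induct)
  case empty
  with assms(1) show ?case by (auto simp: irreducible_closedin_def)
next
  case (insert A \<A>)
  then have "closedin X A" "closedin X (\<Union>\<A>)" "Z \<subseteq> A \<union> \<Union>\<A>"
    by (auto intro: closedin_Union)
  with assms(1) have "Z \<subseteq> A \<or> Z \<subseteq> \<Union>\<A>"
    unfolding irreducible_closedin_def by blast
  with insert show ?case by auto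
qed

lemma Inter_irreducible_closedin_mem:
  assumes "irreducible_closedin (Sub_topology act) Z"
  shows "\<Inter>Z \<in> Z"
proof (rule ccontr)
  assume notin: "\<Inter>Z \<notin> Z"
  have closed: "closedin (Sub_topology act) Z"
    using assms by (simp add: irreducible_closedin_def)
  then have sub: "Z \<subseteq> Sub act"
    using closedin_subset by fastforce
  have "openin (Sub_topology act) (Sub act - Z)"
    using closed by (simp add: closedin_def)
  moreover have "\<Inter>Z \<in> Sub act - Z"
    using notin Inter_in_Sub[OF sub] by blast
  ultimately obtain \<F> where \<F>: "finite \<F>" "\<forall>F\<in>\<F>. finite F"
    "\<Inter>Z \<in> Sub act \<inter> \<Inter>(D act ` \<F>)" "Sub act \<inter> \<Inter>(D act ` \<F>) \<subseteq> Sub act - Z"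
    by (rule Sub_topology_base_neighbourhood)
  \<comment> \<open>The basic neighbourhood of \<open>\<Inter>Z\<close> avoids \<open>Z\<close>, so
    each member of \<open>Z\<close> fails to lie in some \<open>D act F\<close> and therefore lies
    in \<open>V act F\<close>.\<close>
  have "Z \<subseteq> \<Union>(V act ` \<F>)"
    using \<F>(4) sub unfolding D_def by blast
  then obtain F where "F \<in> \<F>" "Z \<subseteq> V act F"
    using irreducible_closedin_Union[OF assms, of "V act ` \<F>"] \<F>(1,2) closedin_V by blast
  then have "F \<subseteq> \<Inter>Z"
    by (auto simp: V_def)
  with \<F>(3) \<open>F \<in> \<F>\<close> show False
    unfolding D_def V_def by blast
qed

lemma irreducible_closedin_Sub_topology_generic_point:
  assumes "irreducible_closedin (Sub_topology act) Z"
  shows "\<exists>!N. N \<in> topspace (Sub_topology act) \<and> Sub_topology act closure_of {N} = Z"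
proof -
  have closed: "closedin (Sub_topology act) Z"
    using assms by (simp add: irreducible_closedin_def)
  then have sub: "Z \<subseteq> Sub act"
    using closedin_subset by fastforce
  note mem = Inter_irreducible_closedin_mem[OF assms]
  show ?thesis
  proof (rule ex1I[of _ "\<Inter>Z"])
    have "Sub_topology act closure_of {\<Inter>Z} \<subseteq> Z"
      using mem closed by (intro closure_of_minimal) auto
    moreover have "Z \<subseteq> Sub_topology act closure_of {\<Inter>Z}"
      using mem sub by (subst closure_of_singleton_Sub_topology) auto
    ultimately show "\<Inter>Z \<in> topspace (Sub_topology act) \<and> Sub_topology act closure_of {\<Inter>Z} = Z"
      using mem sub by auto
  next
    fix N assume "N \<in> topspace (Sub_topology act) \<and> Sub_topology act closure_of {N} = Z"
    then have "N \<in> Sub act" "Z = {N' \<in> Sub act. N \<subseteq> N'}"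
      by (auto simp: closure_of_singleton_Sub_topology)
    \<comment> \<open>\<open>N\<close> is the least submodule in its own closure, so the closure
      determines it as the intersection.\<close>
    then show "N = \<Inter>Z" by blast
  qed
qed

section \<open>Assembling spectrality and the subbase statement\<close>

lemma spectral_space_Sub_topology: "spectral_space (Sub_topology act)"
  unfolding spectral_space_def
proof (intro conjI allI impI)
  show "openin (Sub_topology act) =
      arbitrary union_of (\<lambda>A. openin (Sub_topology act) A \<and> compactin (Sub_topology act) A)"
    by (rule openin_Sub_topology_compact_base)
qed (simp_all add: compact_space_Sub_topology compactin_Int_Sub_topology
    irreducible_closedin_Sub_topology_generic_point[simplified])

theorem proposition11p1:
  fixes act :: "'h::heyting_algebra \<Rightarrow> 'm::bounded_semilattice_sup_bot \<Rightarrow> 'm"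
  assumes "heyting_module act"
  shows "spectral_space (Sub_topology act) \<and>
    (\<forall>F. finite F \<longrightarrow> openin (Sub_topology act) (D act F) \<and> compactin (Sub_topology act) (D act F)) \<and>
    open_subbase (Sub_topology act) {D act F | F. finite F}"
  by (intro conjI allI impI spectral_space_Sub_topology openin_D compactin_D
      open_subbase_Sub_topology)

end
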